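(* Let $n\ge 3$ and let $F$ be a polygonal Heronian frieze of order $n$, arising from a labeled $n$-gon $P=(A_1,\dots,A_n)$ in the complex plane. Then the determinant of every $4\times4$ diamond of the $S$-subfrieze of $F$ is zero. That is, for all integers $r,m$ with $r+4\le m\le r+n-3$, $$\det\big(S_{r+i-1,\;r+i,\;m+j-1}\big)_{1\le i,j\le 4}=0,$$ where indices are reduced modulo $n$ to representatives in $\{1,\dots,n\}$.
   Context: A labeled $n$-gon is an ordered $n$-tuple of points $A_m=(x_m,y_m)$ of the complex plane (coordinates may be complex numbers). For $i,j,k\in\{1,\dots,n\}$ put $S_{ijk}=2[(x_j-x_i)(y_k-y_i)-(y_j-y_i)(x_k-x_i)]$ (four times the signed area of the triangle $A_iA_jA_k$). The polygonal Heronian frieze $F$ of order $n$ arising from $P$ is the array whose entries are the squared distances $(x_j-x_i)^2+(y_j-y_i)^2$ and the numbers $S_{a,a+1,b}$, $S_{a,b,b+1}$, with $a,b\in\{1,\dots,n\}$ and indices modulo $n$. The $S$-subfrieze of $F$ consists of the $S$-entries on alternating diagonals: for each $a$ (modulo $n$) it has a diagonal going from south-west to north-east with entries $S_{a,a+1,a+1},S_{a,a+1,a+2},\dots,S_{a,a+1,a+n}=S_{a,a+1,a}$, and consecutive diagonals ($a$, $a+1$, $\dots$) are placed from left to right so that the entry immediately south-east of $S_{a,a+1,b}$ is $S_{a+1,a+2,b}$. Hence a horizontal row consists of $S_{a,a+1,b},S_{a+1,a+2,b+1},S_{a+2,a+3,b+2},\dots$. A $4\times4$ diamond of the $S$-subfrieze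 is a matrix having four successive entries of a row of the subfrieze on its diagonal and the shorter rows above and below that row placed above and below the diagonal accordingly; that is, it is a matrix $(S_{r+i-1,r+i,m+j-1})_{1\le i,j\le4}$ all of whose entries lie in the subfrieze (which is the condition $r+4\le m\le r+n-3$). *)

theory Defs
  imports Complex_Main "Jordan_Normal_Form.Determinant"
begin

text \<open>A labeled n-gon in the complex plane is an ordered n-tuple of points of \<open>\<complex> \<times> \<complex>\<close>
  (both coordinates are complex). Vertices are labeled \<open>1, \<dots>, n\<close>.\<close>

type_synonym polygon = "(complex \<times> complex) list"

definition labeled_polygon :: "nat \<Rightarrow> polygon \<Rightarrow> bool" where
  "labeled_polygon n P \<longleftrightarrow> length P = n"

definition vx :: "polygon \<Rightarrow> nat \<Rightarrow> complex" where
  "vx P i = fst (P ! (i - 1))"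

definition vy :: "polygon \<Rightarrow> nat \<Rightarrow> complex" where
  "vy P i = snd (P ! (i - 1))"

definition sqdist :: "polygon \<Rightarrow> nat \<Rightarrow> nat \<Rightarrow> complex" where
  "sqdist P i j = (vx P j - vx P i)^2 + (vy P j - vy P i)^2"

definition area4 :: "polygon \<Rightarrow> nat \<Rightarrow> nat \<Rightarrow> nat \<Rightarrow> complex" where
  "area4 P i j k =
     2 * ((vx P j - vx P i) * (vy P k - vy P i) - (vy P j - vy P i) * (vx P k - vx P i))"

text \<open>The representative in \<open>{1, \<dots>, n}\<close> of an integer modulo \<open>n\<close>.\<close>

definition ix :: "nat \<Rightarrow> int \<Rightarrow> nat" where
  "ix n k = nat ((k - 1) mod int n) + 1"

text \<open>The three families of entries of a Heronian frieze, indexed by integers \<open>a\<close>, \<open>b\<close>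
  (read modulo the order): the squared distances, and, in the polygonal case, the numbers
  \<open>S\<^bsub>a,a+1,b\<^esub>\<close> (\<open>fr_S\<close>) and \<open>S\<^bsub>a,b,b+1\<^esub>\<close> (\<open>fr_S'\<close>).\<close>

record heronian_frieze =
  fr_order :: nat
  fr_d  :: "int \<Rightarrow> int \<Rightarrow> complex"
  fr_S  :: "int \<Rightarrow> int \<Rightarrow> complex"
  fr_S' :: "int \<Rightarrow> int \<Rightarrow> complex"

definition polygonal_frieze :: "nat \<Rightarrow> polygon \<Rightarrow> heronian_frieze" where
  "polygonal_frieze n P =
     \<lparr> fr_order = n,
       fr_d  = (\<lambda>a b. sqdist P (ix n a) (ix n b)),
       fr_S  = (\<lambda>a b. area4 P (ix n a) (ix n (a + 1)) (ix n b)),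
       fr_S' = (\<lambda>a b. area4 P (ix n a) (ix n b) (ix n (b + 1))) \<rparr>"

text \<open>Positions of the S-subfrieze: the south-west to north-east diagonal labeled \<open>a\<close> consists of
  \<open>S\<^bsub>a,a+1,b\<^esub>\<close> for \<open>b = a+1, \<dots>, a+n\<close>, so the row through position \<open>(a, b)\<close> consists of the
  positions \<open>(a + t, b + t)\<close>.\<close>

definition S_subfrieze_positions :: "heronian_frieze \<Rightarrow> (int \<times> int) set" where
  "S_subfrieze_positions F = {(a, b). a + 1 \<le> b \<and> b \<le> a + int (fr_order F)}"

text \<open>Matrix indices start at \<open>0\<close>, so the entry \<open>(i, j)\<close> below is \<open>S\<^bsub>r+i,r+i+1,m+j\<^esub>\<close>. The diagonal
  consists of the four successive row entries at \<open>(r + i, m + i)\<close>.\<close>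

definition S_diamond :: "heronian_frieze \<Rightarrow> int \<Rightarrow> int \<Rightarrow> complex mat" where
  "S_diamond F r m = mat 4 4 (\<lambda>(i, j). fr_S F (r + int i) (m + int j))"

definition S_diamonds :: "heronian_frieze \<Rightarrow> complex mat set" where
  "S_diamonds F = {S_diamond F r m | r m.
     \<forall>i < (4::nat). \<forall>j < (4::nat). (r + int i, m + int j) \<in> S_subfrieze_positions F}"

lemma S_diamond_positions_iff:
  "(\<forall>i < (4::nat). \<forall>j < (4::nat). (r + int i, m + int j) \<in> S_subfrieze_positions F) \<longleftrightarrow>
   r + 4 \<le> m \<and> m \<le> r + int (fr_order F) - 3"
proof
  assume *: "\<forall>i < (4::nat). \<forall>j < (4::nat). (r + int i, m + int j) \<in> S_subfrieze_positions F"
  show "r + 4 \<le> m \<and> m \<le> r + int (fr_order F) - 3"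
    using *[rule_format, of 3 0] *[rule_format, of 0 3]
    by (auto simp: S_subfrieze_positions_def)
next
  assume "r + 4 \<le> m \<and> m \<le> r + int (fr_order F) - 3"
  then show "\<forall>i < (4::nat). \<forall>j < (4::nat). (r + int i, m + int j) \<in> S_subfrieze_positions F"
    by (auto simp: S_subfrieze_positions_def)
qed

end

theory Submission imports Defs begin

text \<open>
  For a fixed edge from \<open>A\<^sub>i\<close> to \<open>A\<^sub>j\<close>, the quantity \<open>S\<^bsub>ijk\<^esub>\<close> is an affine function of the third
  vertex \<open>A\<^sub>k = (x\<^sub>k, y\<^sub>k)\<close>, hence a linear form in the vector \<open>(1, x\<^sub>k, y\<^sub>k)\<close> of length three. A diamond
  has rows indexed by edges and columns indexed by third vertices, so it is the product of a
  \<open>4 \<times> 3\<close> matrix (the coefficients of the four forms) and a \<open>3 \<times> 4\<close> matrix (the coordinates of the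
  four vertices). Such a product has rank at most three, so its determinant vanishes; this is
  \<open>det_mult_smaller_inner_dim\<close>.
\<close>

lemma det_zero_row:
  fixes A :: "'a :: comm_ring_1 mat"
  assumes "A \<in> carrier_mat n n" and "k < n" and "\<And>j. j < n \<Longrightarrow> A $$ (k, j) = 0"
  shows "det A = 0"
  using laplace_expansion_row[OF assms(1,2)] assms(3) by simp

text \<open>
  Padding both factors with zeros to square matrices does not change their product but gives the
  second factor a zero row. This replaces the rank argument and works over any commutative ring.
\<close>

lemma det_mult_smaller_inner_dim:
  fixes A B :: "'a :: comm_ring_1 mat"
  assumes A: "A \<in> carrier_mat n m" and B: "B \<in> carrier_mat m n" and "m < n"
  shows "det (A * B) = 0"
proof -
  define A' where "A' = mat n n (\<lambda>(i, j). if j < m then A $$ (i, j) else 0)"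
  define B' where "B' = mat n n (\<lambda>(i, j). if i < m then B $$ (i, j) else 0)"
  have carrier: "A' \<in> carrier_mat n n" "B' \<in> carrier_mat n n"
    by (simp_all add: A'_def B'_def)
  have "A * B = A' * B'"
  proof (rule eq_matI)
    fix i j
    assume "i < dim_row (A' * B')" "j < dim_col (A' * B')"
    then have ij: "i < n" "j < n"
      using carrier by auto
    have "(A * B) $$ (i, j) = (\<Sum>k = 0..<m. A $$ (i, k) * B $$ (k, j))"
      using A B ij by (simp add: scalar_prod_def)
    also have "\<dots> = (\<Sum>k = 0..<n. A' $$ (i, k) * B' $$ (k, j))"
      using ij \<open>m < n\<close> by (intro sum.mono_neutral_cong_left) (auto simp: A'_def B'_def)
    also have "\<dots> = (A' * B') $$ (i, j)"
      using carrier ij by (simp add: scalar_prod_def)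
    finally show "(A * B) $$ (i, j) = (A' * B') $$ (i, j)" .
  qed (use A B carrier in auto)
  moreover have "det B' = 0"
    by (rule det_zero_row[OF carrier(2) \<open>m < n\<close>]) (use \<open>m < n\<close> in \<open>simp add: B'_def\<close>)
  ultimately show ?thesis
    using det_mult[OF carrier] by simp
qed

lemma det_area4_matrix:
  fixes p q s :: "nat \<Rightarrow> nat"
  assumes "n > 3"
  shows "det (mat n n (\<lambda>(i, j). area4 P (p i) (q i) (s j))) = 0"
proof -
  \<comment> \<open>Row \<open>i\<close> holds the coefficients of \<open>S\<close> for the edge from \<open>p i\<close> to \<open>q i\<close>, as a linear form in
    \<open>(1, x, y)\<close>: the determinant of the two end points, and the two coordinate differences.\<close>
  define A where "A = mat n 3 (\<lambda>(i, k).
    [2 * (vx P (p i) * vy P (q i) - vx P (q i) * vy P (p i)),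
     2 * (vy P (p i) - vy P (q i)),
     2 * (vx P (q i) - vx P (p i))] ! k)"
  define B where "B = mat 3 n (\<lambda>(k, j). [1, vx P (s j), vy P (s j)] ! k)"
  have "mat n n (\<lambda>(i, j). area4 P (p i) (q i) (s j)) = A * B"
    by (rule eq_matI)
      (simp_all add: A_def B_def scalar_prod_def numeral_3_eq_3 area4_def algebra_simps)
  moreover have "det (A * B) = 0"
    using assms by (intro det_mult_smaller_inner_dim[where m = 3]) (simp_all add: A_def B_def)
  ultimately show ?thesis
    by simp
qed

theorem theorem4p27:
  fixes n :: nat and P :: polygon and F :: heronian_frieze
  assumes "n \<ge> 3"
    and "labeled_polygon n P"
    and "F = polygonal_frieze n P"
  shows "(\<forall>D \<in> S_diamonds F. det D = 0) \<and>
    (\<forall>r m :: int. r + 4 \<le> m \<and> m \<le> r + int n - 3 \<longrightarrow>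
       det (mat 4 4 (\<lambda>(i, j).
         area4 P (ix n (r + int i)) (ix n (r + int i + 1)) (ix n (m + int j)))) = 0)"
proof -
  have "det (mat 4 4 (\<lambda>(i, j).
      area4 P (ix n (r + int i)) (ix n (r + int i + 1)) (ix n (m + int j)))) = 0" for r m
    by (rule det_area4_matrix) simp
  then show ?thesis
    by (auto simp: S_diamonds_def S_diamond_def assms(3) polygonal_frieze_def)
qed

end
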